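(* For all integers $1\le k\le n$, $$V_{n,k}(t)=\sum_{\tau\in\mathcal{T}^\circ_{n,n-k+1}} t^{\mathrm{emp}(\tau)}\quad\text{and}\quad V_{n,-k}(t)=\sum_{\tau\in\mathcal{T}^\ast_{n,n-k+1}} t^{\mathrm{emp}(\tau)}.$$
   Context: The polynomials $V_{n,k}=V_{n,k}(t)$, for integers $n\ge1$ and $1\le |k|\le n$, are defined by $V_{1,1}=t^2$, $V_{1,-1}=1$, $V_{n,-n}=0$ for $n\ge 2$, and the recurrences $V_{n,-k}=V_{n,-k-1}+t^{-1}V_{n-1,k}$ for $n>k\ge 1$; $V_{n,1}=t^2\,V_{n,-1}$ for $n\ge 2$; $V_{n,k}=V_{n,k-1}+t\,V_{n-1,-k+1}$ for $n\ge k>1$. A plane binary tree is complete if every internal node has exactly two children, a left child and a right child. For $n\ge1$, $\mathcal{T}_n$ is the set of complete plane binary trees with exactly $n$ labelled nodes, labelled bijectively by $1,\dots,n$, such that every internal node is labelled, leaves may be labelled or non-labelled (non-labelled leaves are called empty leaves), and labels increase from the root to the leaves. (For $n=1$, $\mathcal{T}_1$ consists of the single vertex labelled $1$, and the root labelled $1$ with two empty leaves.) $\mathrm{emp}(\tau)$ is the number of empty leaves of $\tau$. The rightmost path of $\tau$ is the sequence $(u_1,\dots,u_d)$ where $u_1$ is the root, $u_j$ is the right child of $u_{j-1}$ for $2\le j\le d$, and $u_d$ is a leaf (the rightmost leaf). $\mathcal{T}^\ast_n$ (resp. $\mathcal{T}^\circ_n$) is the set of $\tau\in\mathcal{T}_n$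 whose rightmost leaf is labelled (resp. empty). $\mathrm{rmlab}(\tau)$ is the label of the last labelled node of the rightmost path, i.e. the label of $u_d$ if $u_d$ is labelled and of $u_{d-1}$ otherwise. For $1\le k\le n$, $\mathcal{T}^\ast_{n,k}=\{\tau\in\mathcal{T}^\ast_n:\mathrm{rmlab}(\tau)=k\}$ and $\mathcal{T}^\circ_{n,k}=\{\tau\in\mathcal{T}^\circ_n:\mathrm{rmlab}(\tau)=k\}$. *)

theory Defs
  imports "HOL-Computational_Algebra.Formal_Laurent_Series"
begin

text \<open>
  The recurrence for \<open>V\<close> uses \<open>t\<^sup>-\<^sup>1\<close>, so it is stated among Laurent series over the integers,
  with \<open>t = fls_X\<close> and \<open>t\<^sup>-\<^sup>1 = fls_X_inv\<close>. Outside the index range \<open>1 \<le> \<bar>k\<bar> \<le> n\<close>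
  the value \<open>0\<close> is a dummy, never reached by the recurrence from inside the range.
\<close>

function V :: "nat \<Rightarrow> int \<Rightarrow> int fls" where
  "V n k =
    (if k = 0 \<or> \<bar>k\<bar> > int n then 0
     else if n = 1 then (if k = 1 then fls_X ^ 2 else 1)
     else if k = - int n then 0
     else if k < 0 then V n (k - 1) + fls_X_inv * V (n - 1) (- k)
     else if k = 1 then fls_X ^ 2 * V n (- 1)
     else V n (k - 1) + fls_X * V (n - 1) (- k + 1))"
  by pat_completeness auto
termination
  by (relation "measures [\<lambda>(n, k). n, \<lambda>(n, k). nat (k + int n)]") auto

declare V.simps [simp del]

lemma V_1_1: "V 1 1 = fls_X ^ 2"
  by (simp add: V.simps)

lemma V_1_minus_1: "V 1 (- 1) = 1"
  by (simp add: V.simps)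

lemma V_minus_self: "n \<ge> 2 \<Longrightarrow> V n (- int n) = 0"
  by (subst V.simps) auto

lemma V_minus:
  "1 \<le> k \<Longrightarrow> k < n \<Longrightarrow> V n (- int k) = V n (- int k - 1) + fls_X_inv * V (n - 1) (int k)"
  by (subst V.simps) auto

lemma V_one: "n \<ge> 2 \<Longrightarrow> V n 1 = fls_X ^ 2 * V n (- 1)"
  by (subst V.simps) auto

lemma V_plus:
  "1 < k \<Longrightarrow> k \<le> n \<Longrightarrow> V n (int k) = V n (int k - 1) + fls_X * V (n - 1) (- int k + 1)"
  by (subst V.simps) auto

text \<open>Complete plane binary trees; \<open>Leaf None\<close> is an empty leaf.\<close>

datatype btree = Leaf "nat option" | Node btree nat btree

fun labels :: "btree \<Rightarrow> nat list" where
  "labels (Leaf None) = []"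
| "labels (Leaf (Some a)) = [a]"
| "labels (Node l a r) = labels l @ a # labels r"

fun increasing :: "btree \<Rightarrow> bool" where
  "increasing (Leaf x) \<longleftrightarrow> True"
| "increasing (Node l a r) \<longleftrightarrow>
     (\<forall>b \<in> set (labels l) \<union> set (labels r). a < b) \<and> increasing l \<and> increasing r"

fun emp :: "btree \<Rightarrow> nat" where
  "emp (Leaf None) = 1"
| "emp (Leaf (Some a)) = 0"
| "emp (Node l a r) = emp l + emp r"

definition trees :: "nat \<Rightarrow> btree set" where
  "trees n = {\<tau>. distinct (labels \<tau>) \<and> set (labels \<tau>) = {1..n} \<and> increasing \<tau>}"

text \<open>The labels along the rightmost path, from the root to the rightmost leaf; \<open>None\<close> can
  only occur at the end.\<close>

fun rightmost_path :: "btree \<Rightarrow> nat option list" where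
  "rightmost_path (Leaf x) = [x]"
| "rightmost_path (Node l a r) = Some a # rightmost_path r"

definition rmlab :: "btree \<Rightarrow> nat" where
  "rmlab \<tau> = the (last (filter (\<lambda>x. x \<noteq> None) (rightmost_path \<tau>)))"

definition trees_star :: "nat \<Rightarrow> nat \<Rightarrow> btree set" where
  "trees_star n k = {\<tau> \<in> trees n. last (rightmost_path \<tau>) \<noteq> None \<and> rmlab \<tau> = k}"

definition trees_circ :: "nat \<Rightarrow> nat \<Rightarrow> btree set" where
  "trees_circ n k = {\<tau> \<in> trees n. last (rightmost_path \<tau>) = None \<and> rmlab \<tau> = k}"

end

theory Submission
  imports Defs "HOL-Combinatorics.Transposition"
begin

text \<open>
  Write \<open>C A j\<close> and \<open>S A j\<close> for the sums of \<open>t ^ emp \<tau>\<close> over the increasing trees with label set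
  \<open>A\<close> whose rightmost path ends with the label \<open>j\<close>, the rightmost leaf being empty or labelled,
  respectively. With \<open>A = {1..n}\<close> and \<open>j = n - k + 1\<close>, the claim says that these sums satisfy the
  recurrence and the boundary values of \<open>V\<close>:

  \<^item> \<open>S A (i + 1) = S A i + t\<^sup>-\<^sup>1 C (A - {i + 1}) i\<close>  (\<open>star_on_Suc\<close>),
  \<^item> \<open>C A i = C A (i + 1) + t S (A - {i + 1}) i\<close>  (\<open>circ_on_Suc\<close>),
  \<^item> \<open>C A m = t\<^sup>2 S A m\<close> for the greatest label \<open>m\<close>  (\<open>circ_on_greatest\<close>),
  \<^item> \<open>S A m = 0\<close> for the least label \<open>m\<close>, unless \<open>A = {m}\<close>  (\<open>star_on_least\<close>).

  The first two come from exchanging the labels \<open>i\<close> and \<open>i + 1\<close>. The exchange turns trees ending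
  with \<open>i\<close> into trees ending with \<open>i + 1\<close> and back, and it keeps labels increasing exactly when
  \<open>i + 1\<close> does not lie below \<open>i\<close>; so \<open>i\<close> and \<open>i + 1\<close> contribute equally apart from the trees in
  which \<open>i + 1\<close> lies below \<open>i\<close>. Then \<open>i + 1\<close> is a child of \<open>i\<close>, and the shape of
  the tree around the two is known:

  \<^item> In a tree ending with the labelled leaf \<open>i + 1\<close>, this leaf hangs on the right of \<open>i\<close>.
    Emptying it gives an arbitrary tree on \<open>A - {i + 1}\<close> ending with \<open>i\<close> and an empty leaf.
  \<^item> In a tree ending with \<open>i\<close> and an empty leaf, \<open>i + 1\<close> is the left child of \<open>i\<close>. If it is a
    leaf, contracting \<open>i\<close> and its two children to the leaf \<open>i\<close> gives an arbitrary tree on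
    \<open>A - {i + 1}\<close> ending with the labelled leaf \<open>i\<close>. If it is internal, rotating the edge between
    \<open>i\<close> and \<open>i + 1\<close> matches these trees with the exceptional ones that end with \<open>i + 1\<close> and an
    empty leaf.

  Arbitrary label sets are allowed so that deleting a label and closing the gap it
  leaves are separate steps; the second is an order-preserving relabelling (\<open>gf_remove_label\<close>).
\<close>

section \<open>Trees with an arbitrary label set\<close>

definition trees_on :: "nat set \<Rightarrow> btree set" where
  "trees_on A = {\<tau>. distinct (labels \<tau>) \<and> set (labels \<tau>) = A \<and> increasing \<tau>}"

lemma finite_trees_on:
  assumes "finite A"
  shows "finite (trees_on A)"
  using assms
proof (induction A rule: finite_psubset_induct)
  case (psubset A)
  let ?U = "\<Union>B\<in>{B. B \<subset> A}. trees_on B"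
  let ?N = "(\<lambda>(l, a, r). Node l a r) ` (?U \<times> A \<times> ?U)"
  have "finite {B. B \<subset> A}"
    by (rule finite_subset[of _ "Pow A"]) (auto simp: psubset.hyps)
  then have fin: "finite ?U"
    using psubset.IH by auto
  have "trees_on A \<subseteq> Leaf ` insert None (Some ` A) \<union> ?N"
  proof
    fix \<tau> assume \<tau>: "\<tau> \<in> trees_on A"
    show "\<tau> \<in> Leaf ` insert None (Some ` A) \<union> ?N"
    proof (cases \<tau>)
      case (Leaf x)
      then show ?thesis using \<tau> by (cases x) (auto simp: trees_on_def)
    next
      case (Node l a r)
      then have "set (labels l) \<subset> A" "set (labels r) \<subset> A" "a \<in> A"
        "l \<in> trees_on (set (labels l))" "r \<in> trees_on (set (labels r))"
        using \<tau> by (auto simp: trees_on_def)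
      then show ?thesis
        unfolding Node by (intro UnI2 image_eqI[of _ _ "(l, a, r)"]) auto
    qed
  qed
  then show ?case
    by (rule finite_subset) (use fin psubset.hyps in auto)
qed

text \<open>
  A tree is handled through its rightmost path: the list holds the left subtrees and labels of
  the nodes met on the way down, and the last argument is the tree at which the descent stops.
\<close>

fun graft :: "(btree \<times> nat) list \<Rightarrow> btree \<Rightarrow> btree" where
  "graft [] X = X"
| "graft ((l, a) # p) X = Node l a (graft p X)"

lemma graft_append: "graft (p @ q) X = graft p (graft q X)"
  by (induction p X rule: graft.induct) auto

text \<open>
  The rightmost path of a tree is unique. The parametrisations of tree families by the data around
  the end of the path are therefore injective.
\<close>

lemma graft_Leaf_inject: "graft p (Leaf e) = graft q (Leaf f) \<longleftrightarrow> p = q \<and> e = f"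
proof (induction p arbitrary: q)
  case Nil
  show ?case by (cases q) auto
next
  case IH: (Cons x p)
  obtain l a where x: "x = (l, a)" by force
  show ?case
  proof (cases q)
    case Nil
    then show ?thesis by (simp add: x)
  next
    case (Cons y q')
    obtain m b where "y = (m, b)" by force
    then show ?thesis using IH.IH[of q'] by (auto simp: x Cons)
  qed
qed

lemma graft_Node_inject:
  "graft p (Node l a (Leaf e)) = graft q (Node m b (Leaf f)) \<longleftrightarrow>
    p = q \<and> l = m \<and> a = b \<and> e = f"
  using graft_Leaf_inject[of "p @ [(l, a)]" e "q @ [(m, b)]" f]
  by (auto simp: graft_append)

lemma graft_Node_Node_inject:
  "graft p (Node l a (Node l' a' (Leaf e))) = graft q (Node m b (Node m' b' (Leaf f))) \<longleftrightarrow>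
    p = q \<and> l = m \<and> a = b \<and> l' = m' \<and> a' = b' \<and> e = f"
  using graft_Leaf_inject[of "p @ [(l, a), (l', a')]" e "q @ [(m, b), (m', b')]" f]
  by (auto simp: graft_append)

lemma tree_eq_graft: obtains p e where "\<tau> = graft p (Leaf e)"
proof (induction \<tau> arbitrary: thesis)
  case (Leaf x)
  show ?case by (rule Leaf[of "[]" x]) simp
next
  case (Node l a r)
  obtain p e where "r = graft p (Leaf e)" using Node.IH by blast
  then show ?case using Node.prems[of "(l, a) # p" e] by simp
qed

fun spine_labels :: "(btree \<times> nat) list \<Rightarrow> nat list" where
  "spine_labels [] = []"
| "spine_labels ((l, a) # p) = labels l @ a # spine_labels p"

lemma labels_graft: "labels (graft p X) = spine_labels p @ labels X"
  by (induction p X rule: graft.induct) auto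

lemma emp_graft: "emp (graft p X) = sum_list (map (emp \<circ> fst) p) + emp X"
  by (induction p X rule: graft.induct) auto

text \<open>
  Local surgery at the end of the rightmost path: the nodes above see the grafted tree only
  through the lower bounds of its labels. In the applications the two trees have the same least
  label.
\<close>

lemma increasing_graft_cong:
  assumes "increasing X \<longleftrightarrow> increasing Y"
    and "\<And>a. (\<forall>b\<in>set (labels X). a < b) \<longleftrightarrow> (\<forall>b\<in>set (labels Y). a < b)"
  shows "increasing (graft p X) \<longleftrightarrow> increasing (graft p Y)"
proof (induction p)
  case Nil
  show ?case using assms(1) by simp
next
  case (Cons x p)
  obtain l a where "x = (l, a)" by force
  with Cons show ?case using assms(2)[of a] by (auto simp: labels_graft ball_Un)
qed

lemma increasing_graftD: "increasing (graft p X) \<Longrightarrow> increasing X"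
  by (induction p X rule: graft.induct) auto

definition star_on :: "nat set \<Rightarrow> nat \<Rightarrow> btree set" where
  "star_on A j = {\<tau> \<in> trees_on A. \<exists>p. \<tau> = graft p (Leaf (Some j))}"

definition circ_on :: "nat set \<Rightarrow> nat \<Rightarrow> btree set" where
  "circ_on A j = {\<tau> \<in> trees_on A. \<exists>p l. \<tau> = graft p (Node l j (Leaf None))}"

lemma rightmost_path_graft:
  "rightmost_path (graft p X) = map (Some \<circ> snd) p @ rightmost_path X"
  by (induction p X rule: graft.induct) auto

lemma trees_star_eq: "trees_star n j = star_on {1..n} j"
proof -
  have "last (rightmost_path \<tau>) \<noteq> None \<and> rmlab \<tau> = j \<longleftrightarrow> (\<exists>p. \<tau> = graft p (Leaf (Some j)))" for \<tau>
  proof -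
    obtain p e where "\<tau> = graft p (Leaf e)" by (rule tree_eq_graft)
    then show ?thesis
      by (auto simp: rmlab_def rightmost_path_graft graft_Leaf_inject)
  qed
  then show ?thesis
    by (auto simp: trees_star_def star_on_def trees_def trees_on_def)
qed

text \<open>
  The tree consisting of a single empty leaf has no last labelled node; it is the only tree on
  \<open>{1..0}\<close>, hence the restriction on \<open>n\<close>.
\<close>

lemma trees_circ_eq:
  assumes "n \<ge> 1"
  shows "trees_circ n j = circ_on {1..n} j"
proof -
  have "last (rightmost_path \<tau>) = None \<and> rmlab \<tau> = j \<longleftrightarrow>
      (\<exists>p l. \<tau> = graft p (Node l j (Leaf None)))" if \<tau>: "\<tau> \<in> trees n" for \<tau>
  proof -
    obtain p e where p: "\<tau> = graft p (Leaf e)" by (rule tree_eq_graft)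
    show ?thesis
    proof (cases p rule: rev_cases)
      case Nil
      with p have "\<tau> = Leaf e" by simp
      then have "\<tau> \<noteq> graft q (Node l j (Leaf None))" for q l
        by (cases "(q, Node l j (Leaf None))" rule: graft.cases) auto
      moreover have "e \<noteq> None"
        using \<tau> assms \<open>\<tau> = Leaf e\<close> by (intro notI) (simp add: trees_def)
      ultimately show ?thesis
        using \<open>\<tau> = Leaf e\<close> by simp
    next
      case (snoc q x)
      obtain l a where "x = (l, a)" by force
      with snoc p have "\<tau> = graft q (Node l a (Leaf e))" by (simp add: graft_append)
      then show ?thesis
        by (auto simp: rmlab_def rightmost_path_graft graft_Node_inject)
    qed
  qed
  then show ?thesis
    by (auto simp: trees_circ_def circ_on_def trees_def trees_on_def)
qed

definition gf :: "btree set \<Rightarrow> int fls" where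
  "gf S = (\<Sum>\<tau>\<in>S. fls_X ^ emp \<tau>)"

lemma gf_Un: "finite S \<Longrightarrow> finite T \<Longrightarrow> S \<inter> T = {} \<Longrightarrow> gf (S \<union> T) = gf S + gf T"
  by (simp add: gf_def sum.union_disjoint)

lemma gf_Int_Diff: "finite S \<Longrightarrow> gf S = gf (S \<inter> T) + gf (S - T)"
  using gf_Un[of "S \<inter> T" "S - T"] by (simp add: Int_Diff_Un Int_Diff_disjoint)

text \<open>
  The form in which the bijections below are used: two families parametrised by the same set,
  with a constant difference in the number of empty leaves.
\<close>

lemma gf_images:
  assumes "inj_on F P" "inj_on G P" and "\<And>x. x \<in> P \<Longrightarrow> emp (G x) = emp (F x) + m"
  shows "gf (G ` P) = fls_X ^ m * gf (F ` P)"
proof -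
  have "gf (G ` P) = (\<Sum>x\<in>P. fls_X ^ emp (G x))"
    using assms(2) by (simp add: gf_def sum.reindex)
  also have "\<dots> = (\<Sum>x\<in>P. fls_X ^ m * fls_X ^ emp (F x))"
    by (intro sum.cong) (simp_all add: assms(3) power_add mult.commute)
  also have "\<dots> = fls_X ^ m * gf (F ` P)"
    using assms(1) by (simp add: gf_def sum.reindex sum_distrib_left)
  finally show ?thesis .
qed

section \<open>Relabelling\<close>

fun relabel :: "(nat \<Rightarrow> nat) \<Rightarrow> btree \<Rightarrow> btree" where
  "relabel f (Leaf x) = Leaf (map_option f x)"
| "relabel f (Node l a r) = Node (relabel f l) (f a) (relabel f r)"

lemma labels_relabel: "labels (relabel f \<tau>) = map f (labels \<tau>)"
  by (induction \<tau> rule: labels.induct) auto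

lemma emp_relabel: "emp (relabel f \<tau>) = emp \<tau>"
  by (induction \<tau> rule: emp.induct) auto

lemma relabel_graft:
  "relabel f (graft p X) = graft (map (map_prod (relabel f) f) p) (relabel f X)"
  by (induction p X rule: graft.induct) auto

lemma relabel_relabel: "relabel g (relabel f \<tau>) = relabel (g \<circ> f) \<tau>"
  by (induction \<tau>) (auto simp: option.map_comp comp_def)

lemma relabel_ident: "(\<And>x. x \<in> set (labels \<tau>) \<Longrightarrow> f x = x) \<Longrightarrow> relabel f \<tau> = \<tau>"
  by (induction \<tau> rule: labels.induct) auto

lemma relabel_mono_trees_on:
  assumes "strict_mono_on A f" "\<tau> \<in> trees_on A"
  shows "relabel f \<tau> \<in> trees_on (f ` A)"
proof -
  have "increasing \<sigma> \<Longrightarrow> set (labels \<sigma>) \<subseteq> A \<Longrightarrow> increasing (relabel f \<sigma>)" for \<sigma>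
    using assms(1)
    by (induction \<sigma> rule: increasing.induct)
      (auto simp: labels_relabel strict_mono_on_def)
  moreover have "inj_on f A"
    using assms(1) by (rule strict_mono_on_imp_inj_on)
  ultimately show ?thesis
    using assms(2) by (auto simp: trees_on_def labels_relabel distinct_map)
qed

lemma relabel_star_on:
  assumes "relabel f \<tau> \<in> trees_on B" "\<tau> \<in> star_on A j"
  shows "relabel f \<tau> \<in> star_on B (f j)"
  using assms by (force simp: star_on_def relabel_graft)

lemma relabel_circ_on:
  assumes "relabel f \<tau> \<in> trees_on B" "\<tau> \<in> circ_on A j"
  shows "relabel f \<tau> \<in> circ_on B (f j)"
  using assms by (force simp: circ_on_def relabel_graft)

lemma gf_relabel:
  assumes "\<And>\<tau>. \<tau> \<in> S \<Longrightarrow> relabel f \<tau> \<in> T" "\<And>\<tau>. \<tau> \<in> T \<Longrightarrow> relabel g \<tau> \<in> S"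
    and "\<And>\<tau> x. \<tau> \<in> S \<Longrightarrow> x \<in> set (labels \<tau>) \<Longrightarrow> g (f x) = x"
    and "\<And>\<tau> x. \<tau> \<in> T \<Longrightarrow> x \<in> set (labels \<tau>) \<Longrightarrow> f (g x) = x"
  shows "gf S = gf T"
  unfolding gf_def
  by (rule sum.reindex_bij_witness[where j = "relabel f" and i = "relabel g"])
    (auto simp: assms relabel_relabel emp_relabel intro!: relabel_ident)

text \<open>Only the relative order of the labels matters.\<close>

lemma gf_mono_relabel:
  assumes f: "strict_mono_on A f" and j: "j \<in> A"
  shows "gf (star_on (f ` A) (f j)) = gf (star_on A j)"
    and "gf (circ_on (f ` A) (f j)) = gf (circ_on A j)"
proof -
  define g where "g = inv_into A f"
  have inj: "inj_on f A" using f by (rule strict_mono_on_imp_inj_on)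
  have gf_id: "g (f x) = x" if "x \<in> A" for x
    using inj that by (simp add: g_def)
  have g: "strict_mono_on (f ` A) g"
    using f by (auto simp: strict_mono_on_def gf_id)
       (metis f linorder_less_linear order_less_asym strict_mono_onD)
  have gA: "g ` f ` A = A" by (force simp: gf_id)
  have fg: "f (g x) = x" if "x \<in> f ` A" for x
    using that by (auto simp: gf_id)
  have subs: "star_on B k \<subseteq> trees_on B" "circ_on B k \<subseteq> trees_on B" for B k
    by (auto simp: star_on_def circ_on_def)
  have labs: "\<tau> \<in> trees_on B \<Longrightarrow> x \<in> set (labels \<tau>) \<Longrightarrow> x \<in> B" for \<tau> x B
    by (auto simp: trees_on_def)
  have to: "relabel f \<tau> \<in> trees_on (f ` A)" if "\<tau> \<in> trees_on A" for \<tau>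
    using relabel_mono_trees_on[OF f that] by simp
  have inv: "relabel g \<tau> \<in> trees_on A" if "\<tau> \<in> trees_on (f ` A)" for \<tau>
    using relabel_mono_trees_on[OF g that] by (simp add: gA)
  show "gf (star_on (f ` A) (f j)) = gf (star_on A j)"
  proof (rule gf_relabel[where f = g and g = f])
    show "relabel g \<tau> \<in> star_on A j" if "\<tau> \<in> star_on (f ` A) (f j)" for \<tau>
      using relabel_star_on[OF inv that] that subs(1) j by (auto simp: gf_id)
    show "relabel f \<tau> \<in> star_on (f ` A) (f j)" if "\<tau> \<in> star_on A j" for \<tau>
      using relabel_star_on[OF to that] that subs(1) by auto
  qed (use subs(1) labs gf_id fg in blast)+
  show "gf (circ_on (f ` A) (f j)) = gf (circ_on A j)"
  proof (rule gf_relabel[where f = g and g = f])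
    show "relabel g \<tau> \<in> circ_on A j" if "\<tau> \<in> circ_on (f ` A) (f j)" for \<tau>
      using relabel_circ_on[OF inv that] that subs(2) j by (auto simp: gf_id)
    show "relabel f \<tau> \<in> circ_on (f ` A) (f j)" if "\<tau> \<in> circ_on A j" for \<tau>
      using relabel_circ_on[OF to that] that subs(2) by auto
  qed (use subs(2) labs gf_id fg in blast)+
qed

text \<open>Shifting down the labels above a missing one is order-preserving.\<close>

lemma gf_remove_label:
  assumes "1 \<le> i" "i < n"
  shows "gf (star_on ({1..n} - {Suc i}) i) = gf (star_on {1..n - 1} i)"
    and "gf (circ_on ({1..n} - {Suc i}) i) = gf (circ_on {1..n - 1} i)"
proof -
  \<comment> \<open>the inverse shift, which opens the gap at \<open>Suc i\<close>\<close>
  define f where "f x = (if x \<le> i then x else Suc x)" for x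
  have f: "strict_mono_on {1..n - 1} f"
    by (auto simp: strict_mono_on_def f_def)
  have "x \<in> f ` {1..n - 1}" if "x \<in> {1..n} - {Suc i}" for x
    by (rule image_eqI[of _ _ "if x \<le> i then x else x - 1"]) (use that assms in \<open>auto simp: f_def\<close>)
  then have "{1..n} - {Suc i} \<subseteq> f ` {1..n - 1}" by blast
  moreover have "f ` {1..n - 1} \<subseteq> {1..n} - {Suc i}"
    using assms by (auto simp: f_def)
  ultimately have "f ` {1..n - 1} = {1..n} - {Suc i}" by blast
  moreover have "f i = i" by (simp add: f_def)
  ultimately show "gf (star_on ({1..n} - {Suc i}) i) = gf (star_on {1..n - 1} i)"
    and "gf (circ_on ({1..n} - {Suc i}) i) = gf (circ_on {1..n - 1} i)"
    using gf_mono_relabel[OF f, of i] assms by auto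
qed

section \<open>Exchanging two consecutive labels\<close>

text \<open>The labels of the proper descendants of the node labelled \<open>i\<close>.\<close>

fun below :: "nat \<Rightarrow> btree \<Rightarrow> nat set" where
  "below i (Leaf x) = {}"
| "below i (Node l a r) =
    (if a = i then set (labels l) \<union> set (labels r) else below i l \<union> below i r)"

lemma below_subset: "below i \<tau> \<subseteq> set (labels \<tau>)"
  by (induction i \<tau> rule: below.induct) auto

lemma below_greater: "increasing \<tau> \<Longrightarrow> b \<in> below i \<tau> \<Longrightarrow> i < b"
  by (induction i \<tau> rule: below.induct) (auto split: if_splits)

lemma below_eq_empty: "i \<notin> set (labels \<tau>) \<Longrightarrow> below i \<tau> = {}"
  by (induction i \<tau> rule: below.induct) auto

lemma below_graft:
  "distinct (labels (graft p X)) \<Longrightarrow> i \<in> set (labels X) \<Longrightarrow> below i (graft p X) = below i X"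
proof (induction p X rule: graft.induct)
  case (2 l a p X)
  then have "i \<notin> set (labels l)" "i \<noteq> a"
    by (auto simp: labels_graft)
  then show ?case using 2 by (auto simp: below_eq_empty)
qed simp

lemma below_relabel: "inj f \<Longrightarrow> below (f i) (relabel f \<tau>) = f ` below i \<tau>"
  by (induction i \<tau> rule: below.induct)
    (auto simp: labels_relabel image_Un inj_eq)

text \<open>
  Exchanging two consecutive numbers changes no comparison except the one between these two
  numbers, and that comparison is required only if one of their nodes lies below the other.
\<close>

lemma increasing_transpose:
  assumes "increasing \<tau>" "Suc i \<notin> below i \<tau>"
  shows "increasing (relabel (transpose i (Suc i)) \<tau>)"
  using assms
proof (induction \<tau>)
  case (Node l a r)
  let ?s = "transpose i (Suc i)"
  have "?s a < ?s b" if b: "b \<in> set (labels l) \<union> set (labels r)" for b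
  proof -
    have "a < b" "a = i \<Longrightarrow> b \<noteq> Suc i"
      using b Node.prems by auto
    then show ?thesis by (auto simp: transpose_def)
  qed
  moreover have "Suc i \<notin> below i l" "Suc i \<notin> below i r"
    using Node.prems below_subset by (auto split: if_splits)
  ultimately show ?case
    using Node by (auto simp: labels_relabel)
qed simp

definition separated :: "nat \<Rightarrow> btree set" where
  "separated i = {\<tau>. Suc i \<notin> below i \<tau>}"

text \<open>
  Being separated survives the exchange: afterwards \<open>Suc i\<close> is below \<open>i\<close> only if \<open>i\<close> was below
  \<open>Suc i\<close> before, which is impossible in an increasing tree.
\<close>

lemma transpose_trees_on:
  assumes A: "i \<in> A" "Suc i \<in> A" and \<tau>: "\<tau> \<in> trees_on A" "\<tau> \<in> separated i"
  shows "relabel (transpose i (Suc i)) \<tau> \<in> trees_on A \<inter> separated i"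
proof -
  let ?s = "transpose i (Suc i)"
  have "i \<notin> below (Suc i) \<tau>"
    using below_greater[of \<tau> i "Suc i"] \<tau>(1) by (auto simp: trees_on_def)
  then have "Suc i \<notin> ?s ` below (Suc i) \<tau>"
    by (auto simp: transpose_def split: if_splits)
  then have "relabel ?s \<tau> \<in> separated i"
    using below_relabel[of ?s "Suc i" \<tau>] by (simp add: separated_def)
  moreover have "?s ` A = A"
    using A by (simp add: transpose_image_eq)
  moreover have "inj_on ?s A"
    by (rule inj_on_subset[OF inj_transpose]) simp
  ultimately show ?thesis
    using \<tau> increasing_transpose[of \<tau> i]
    by (auto simp: trees_on_def labels_relabel distinct_map separated_def)
qed

text \<open>The exchange is an involution, and so a bijection between the two sets.\<close>

lemma gf_transpose:
  assumes "i \<in> A" "Suc i \<in> A"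
  shows "gf (star_on A i \<inter> separated i) = gf (star_on A (Suc i) \<inter> separated i)"
    and "gf (circ_on A i \<inter> separated i) = gf (circ_on A (Suc i) \<inter> separated i)"
proof -
  let ?s = "transpose i (Suc i)"
  have "relabel ?s \<tau> \<in> star_on A (?s j) \<inter> separated i"
    if "\<tau> \<in> star_on A j \<inter> separated i" for \<tau> j
    using transpose_trees_on[OF assms, of \<tau>] that relabel_star_on[of ?s \<tau> A A j]
    by (auto simp: star_on_def)
  from this[of _ i] this[of _ "Suc i"]
  show "gf (star_on A i \<inter> separated i) = gf (star_on A (Suc i) \<inter> separated i)"
    by (intro gf_relabel[where f = ?s and g = ?s]) auto
  have "relabel ?s \<tau> \<in> circ_on A (?s j) \<inter> separated i"
    if "\<tau> \<in> circ_on A j \<inter> separated i" for \<tau> j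
    using transpose_trees_on[OF assms, of \<tau>] that relabel_circ_on[of ?s \<tau> A A j]
    by (auto simp: circ_on_def)
  from this[of _ i] this[of _ "Suc i"]
  show "gf (circ_on A i \<inter> separated i) = gf (circ_on A (Suc i) \<inter> separated i)"
    by (intro gf_relabel[where f = ?s and g = ?s]) auto
qed

text \<open>
  No label fits strictly between \<open>i\<close> and \<open>Suc i\<close>. So if \<open>Suc i\<close> lies on the rightmost path and below
  \<open>i\<close>, then \<open>i\<close> is on the path as well, and it is the immediate predecessor of \<open>Suc i\<close>.
\<close>

lemma not_separated_graft:
  assumes "distinct (labels (graft p X))" "increasing (graft p X)"
    and X: "X = Leaf (Some (Suc i)) \<or> X = Node l (Suc i) r"
  shows "graft p X \<notin> separated i \<longleftrightarrow> (\<exists>q m. p = q @ [(m, i)])"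
proof
  assume "graft p X \<notin> separated i"
  then show "\<exists>q m. p = q @ [(m, i)]"
    using assms
  proof (induction p)
    case Nil
    then show ?case
      using below_subset by (fastforce simp: separated_def)
  next
    case (Cons x p)
    obtain m a where x: "x = (m, a)" by force
    have Suc_i: "Suc i \<in> set (labels (graft p X))"
      using X by (auto simp: labels_graft)
    show ?case
    proof (cases "a = i")
      case True
      \<comment> \<open>the next node on the path would have a label between \<open>i\<close> and \<open>Suc i\<close>\<close>
      have "p = []"
      proof (rule ccontr)
        assume "p \<noteq> []"
        then obtain m' a' p' where "p = (m', a') # p'" by (cases p) auto
        then have "i < a'" "a' < Suc i"
          using Cons.prems X x True by (auto simp: labels_graft)
        then show False by simp
      qed
      then show ?thesis using x True by auto
    next
      case False
      have "Suc i \<notin> below i m"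
        using Suc_i below_subset[of i m] Cons.prems x by auto
      then have "graft p X \<notin> separated i"
        using Cons.prems(1) x False by (simp add: separated_def)
      then obtain q m' where "p = q @ [(m', i)]"
        using Cons.IH Cons.prems x X by auto
      then have "x # p = (x # q) @ [(m', i)]" by simp
      then show ?thesis by blast
    qed
  qed
next
  assume "\<exists>q m. p = q @ [(m, i)]"
  then obtain q m where p: "p = q @ [(m, i)]" by blast
  have "below i (graft p X) = below i (Node m i X)"
    using assms(1) below_graft[of q "Node m i X" i] by (simp add: p graft_append)
  moreover have "Suc i \<in> set (labels X)"
    using X by (elim disjE) simp_all
  ultimately show "graft p X \<notin> separated i"
    by (simp add: separated_def)
qed

section \<open>Recurrences for the generating functions\<close>

lemma finite_star_on: "finite A \<Longrightarrow> finite (star_on A j)"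
  by (simp add: star_on_def finite_trees_on)

lemma finite_circ_on: "finite A \<Longrightarrow> finite (circ_on A j)"
  by (simp add: circ_on_def finite_trees_on)

text \<open>
  A tree ending with the leaf \<open>i\<close> is always separated, because nothing is below a leaf. The
  exceptional trees ending with the leaf \<open>Suc i\<close> correspond to trees without that label by emptying
  the leaf, which adds one empty leaf.
\<close>

lemma star_on_Suc:
  assumes "finite A" "i \<in> A" "Suc i \<in> A"
  shows "gf (star_on A (Suc i)) = gf (star_on A i) + fls_X_inv * gf (circ_on (A - {Suc i}) i)"
proof -
  define P where "P = {(p, l). graft p (Node l i (Leaf None)) \<in> trees_on (A - {Suc i})}"
  define F where "F = (\<lambda>(p, l). graft p (Node l i (Leaf (Some (Suc i)))))"
  define G where "G = (\<lambda>(p, l). graft p (Node l i (Leaf None)))"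
  have iff: "graft p (Node l i (Leaf (Some (Suc i)))) \<in> trees_on A \<longleftrightarrow>
      graft p (Node l i (Leaf None)) \<in> trees_on (A - {Suc i})" for p l
  proof -
    have "increasing (graft p (Node l i (Leaf (Some (Suc i))))) \<longleftrightarrow>
        increasing (graft p (Node l i (Leaf None)))"
      by (rule increasing_graft_cong) auto
    then show ?thesis
      using assms(3) by (auto simp: trees_on_def labels_graft)
  qed
  have "star_on A (Suc i) - separated i = F ` P"
  proof (intro set_eqI iffI)
    fix \<tau> assume \<tau>: "\<tau> \<in> star_on A (Suc i) - separated i"
    then obtain p where p: "\<tau> = graft p (Leaf (Some (Suc i)))" "\<tau> \<in> trees_on A"
      by (auto simp: star_on_def)
    then obtain q m where "p = q @ [(m, i)]"
      using not_separated_graft[of p "Leaf (Some (Suc i))" i] \<tau> by (auto simp: trees_on_def)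
    with p show "\<tau> \<in> F ` P"
      by (force simp: F_def P_def graft_append iff)
  next
    fix \<tau> assume "\<tau> \<in> F ` P"
    then obtain p l where p: "\<tau> = graft (p @ [(l, i)]) (Leaf (Some (Suc i)))" "\<tau> \<in> trees_on A"
      by (auto simp: F_def P_def iff graft_append)
    then show "\<tau> \<in> star_on A (Suc i) - separated i"
      using not_separated_graft[of "p @ [(l, i)]" "Leaf (Some (Suc i))" i]
      by (auto simp: star_on_def trees_on_def)
  qed
  moreover have "circ_on (A - {Suc i}) i = G ` P"
    by (force simp: G_def P_def circ_on_def)
  moreover have "gf (G ` P) = fls_X ^ 1 * gf (F ` P)"
    by (rule gf_images) (auto simp: inj_on_def F_def G_def graft_Node_inject emp_graft)
  ultimately have "fls_X_inv * gf (circ_on (A - {Suc i}) i)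
      = (fls_X_inv * fls_X) * gf (star_on A (Suc i) - separated i)"
    by (simp add: mult.assoc)
  also have "(fls_X_inv * fls_X :: int fls) = 1"
    by (simp add: fls_X_inv_times_conv_shift)
  finally have 1: "fls_X_inv * gf (circ_on (A - {Suc i}) i) = gf (star_on A (Suc i) - separated i)"
    by simp
  have "star_on A i \<subseteq> separated i"
    using below_graft[where i = i and X = "Leaf (Some i)"]
    by (auto simp: star_on_def separated_def trees_on_def)
  then have "star_on A i \<inter> separated i = star_on A i" by blast
  then show ?thesis
    using gf_Int_Diff[OF finite_star_on[OF assms(1)], of "Suc i" "separated i"]
      gf_transpose(1)[OF assms(2,3)] 1 by simp
qed

text \<open>
  Here both sides have exceptional trees. Those ending with \<open>Suc i\<close> form the family \<open>F\<close>, with \<open>Suc i\<close>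
  the right child of \<open>i\<close>. Those ending with \<open>i\<close> have \<open>Suc i\<close> as left child of \<open>i\<close> and form two
  families: \<open>G\<close> (\<open>Suc i\<close> internal), matched with \<open>F\<close> by a rotation, and \<open>K\<close> (\<open>Suc i\<close> a leaf),
  which has one more empty leaf than its contraction \<open>H\<close>.
\<close>

lemma circ_on_Suc:
  assumes "finite A" "i \<in> A" "Suc i \<in> A"
  shows "gf (circ_on A i) = gf (circ_on A (Suc i)) + fls_X * gf (star_on (A - {Suc i}) i)"
proof -
  define P where "P = {(p, l, m). graft p (Node l i (Node m (Suc i) (Leaf None))) \<in> trees_on A}"
  define F where "F = (\<lambda>(p, l, m). graft p (Node l i (Node m (Suc i) (Leaf None))))"
  define G where "G = (\<lambda>(p, l, m). graft p (Node (Node l (Suc i) m) i (Leaf None)))"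
  define Q where "Q = {p. graft p (Leaf (Some i)) \<in> trees_on (A - {Suc i})}"
  define H where "H = (\<lambda>p. graft p (Leaf (Some i)))"
  define K where "K = (\<lambda>p. graft p (Node (Leaf (Some (Suc i))) i (Leaf None)))"
  have iffP: "graft p (Node (Node l (Suc i) m) i (Leaf None)) \<in> trees_on A \<longleftrightarrow>
      graft p (Node l i (Node m (Suc i) (Leaf None))) \<in> trees_on A" for p l m
  proof -
    let ?X = "Node (Node l (Suc i) m) i (Leaf None)"
    let ?Y = "Node l i (Node m (Suc i) (Leaf None))"
    show ?thesis
    proof (cases "Suc i \<in> set (labels l)")
      \<comment> \<open>then both trees repeat the label \<open>Suc i\<close>\<close>
      case True
      then show ?thesis by (auto simp: trees_on_def labels_graft)
    next
      case False
      then have "(\<forall>b\<in>set (labels l). Suc i < b) \<longleftrightarrow> (\<forall>b\<in>set (labels l). i < b)"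
        by (metis Suc_lessD Suc_lessI)
      then have "increasing ?X \<longleftrightarrow> increasing ?Y"
        by auto
      then have "increasing (graft p ?X) \<longleftrightarrow> increasing (graft p ?Y)"
        by (rule increasing_graft_cong) auto
      then show ?thesis
        by (auto simp: trees_on_def labels_graft)
    qed
  qed
  have iffQ: "graft p (Node (Leaf (Some (Suc i))) i (Leaf None)) \<in> trees_on A \<longleftrightarrow>
      graft p (Leaf (Some i)) \<in> trees_on (A - {Suc i})" for p
  proof -
    have "increasing (graft p (Node (Leaf (Some (Suc i))) i (Leaf None))) \<longleftrightarrow>
        increasing (graft p (Leaf (Some i)))"
      by (rule increasing_graft_cong) auto
    then show ?thesis
      using assms(3) by (auto simp: trees_on_def labels_graft)
  qed
  have F: "circ_on A (Suc i) - separated i = F ` P"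
  proof (intro set_eqI iffI)
    fix \<tau> assume \<tau>: "\<tau> \<in> circ_on A (Suc i) - separated i"
    then obtain p l where p: "\<tau> = graft p (Node l (Suc i) (Leaf None))" "\<tau> \<in> trees_on A"
      by (auto simp: circ_on_def)
    then obtain q m where "p = q @ [(m, i)]"
      using not_separated_graft[of p "Node l (Suc i) (Leaf None)" i] \<tau> by (auto simp: trees_on_def)
    with p show "\<tau> \<in> F ` P"
      by (force simp: F_def P_def graft_append)
  next
    fix \<tau> assume "\<tau> \<in> F ` P"
    then obtain p l m where
      p: "\<tau> = graft (p @ [(l, i)]) (Node m (Suc i) (Leaf None))" "\<tau> \<in> trees_on A"
      by (auto simp: F_def P_def graft_append)
    then show "\<tau> \<in> circ_on A (Suc i) - separated i"
      using not_separated_graft[of "p @ [(l, i)]" "Node m (Suc i) (Leaf None)" i]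
      by (auto simp: circ_on_def trees_on_def)
  qed
  have GK: "circ_on A i - separated i = G ` P \<union> K ` Q"
  proof (intro set_eqI iffI)
    fix \<tau> assume \<tau>: "\<tau> \<in> circ_on A i - separated i"
    then obtain p l where p: "\<tau> = graft p (Node l i (Leaf None))" "\<tau> \<in> trees_on A"
      by (auto simp: circ_on_def)
    then have Suc_i: "Suc i \<in> set (labels l)"
      using below_graft[of p "Node l i (Leaf None)" i] \<tau> by (auto simp: trees_on_def separated_def)
    have inc: "increasing (Node l i (Leaf None))"
      using p by (auto simp: trees_on_def dest: increasing_graftD)
    show "\<tau> \<in> G ` P \<union> K ` Q"
    proof (cases l)
      case (Leaf x)
      then have "\<tau> = K p"
        using Suc_i p by (cases x) (auto simp: K_def)
      moreover have "p \<in> Q"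
        using \<open>\<tau> = K p\<close> p iffQ[of p] by (simp add: Q_def K_def)
      ultimately show ?thesis by blast
    next
      case (Node l1 a l2)
      have "i < a" "Suc i = a \<or> Suc i \<in> set (labels l1) \<union> set (labels l2)"
        using Node inc Suc_i by auto
      moreover have "\<forall>b\<in>set (labels l1) \<union> set (labels l2). a < b"
        using Node inc by simp
      ultimately have "i < a" "a \<le> Suc i"
        by (blast intro: less_imp_le)+
      then have "a = Suc i" by simp
      then have "\<tau> = G (p, l1, l2)" "(p, l1, l2) \<in> P"
        using Node p iffP[of p l1 l2] by (simp_all add: G_def P_def)
      then show ?thesis by blast
    qed
  next
    fix \<tau> assume "\<tau> \<in> G ` P \<union> K ` Q"
    then obtain p l where p: "\<tau> = graft p (Node l i (Leaf None))" "\<tau> \<in> trees_on A"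
        "Suc i \<in> set (labels l)"
    proof
      assume "\<tau> \<in> G ` P"
      then obtain p l m where "\<tau> = graft p (Node (Node l (Suc i) m) i (Leaf None))" "\<tau> \<in> trees_on A"
        by (auto simp: G_def P_def iffP)
      then show thesis using that[of p "Node l (Suc i) m"] by simp
    next
      assume "\<tau> \<in> K ` Q"
      then obtain p where "\<tau> = graft p (Node (Leaf (Some (Suc i))) i (Leaf None))" "\<tau> \<in> trees_on A"
        by (auto simp: K_def Q_def iffQ)
      then show thesis using that[of p "Leaf (Some (Suc i))"] by simp
    qed
    then show "\<tau> \<in> circ_on A i - separated i"
      using below_graft[of p "Node l i (Leaf None)" i]
      by (auto simp: circ_on_def trees_on_def separated_def)
  qed
  have H: "star_on (A - {Suc i}) i = H ` Q"
    by (auto simp: star_on_def H_def Q_def)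
  have "finite (G ` P \<union> K ` Q)"
    unfolding GK[symmetric] using finite_trees_on[OF assms(1)] by (auto simp: circ_on_def)
  then have "gf (circ_on A i - separated i) = gf (G ` P) + gf (K ` Q)"
    unfolding GK by (intro gf_Un) (auto simp: G_def K_def graft_Node_inject)
  also have "gf (G ` P) = fls_X ^ 0 * gf (F ` P)"
    by (rule gf_images)
      (auto simp: inj_on_def F_def G_def graft_Node_inject graft_Node_Node_inject emp_graft)
  also have "gf (K ` Q) = fls_X ^ 1 * gf (H ` Q)"
    by (rule gf_images)
      (auto simp: inj_on_def H_def K_def graft_Node_inject graft_Leaf_inject emp_graft)
  finally have "gf (circ_on A i - separated i) =
      gf (circ_on A (Suc i) - separated i) + fls_X * gf (star_on (A - {Suc i}) i)"
    by (simp add: F H)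
  then show ?thesis
    using gf_Int_Diff[OF finite_circ_on[OF assms(1)], of i "separated i"]
      gf_Int_Diff[OF finite_circ_on[OF assms(1)], of "Suc i" "separated i"]
      gf_transpose(2)[OF assms(2,3)] by simp
qed

text \<open>
  Nothing can be below the greatest label, so its node has two empty leaves as children and
  contracts to a labelled leaf.
\<close>

lemma circ_on_greatest:
  assumes "\<And>a. a \<in> A \<Longrightarrow> a \<le> m"
  shows "gf (circ_on A m) = fls_X ^ 2 * gf (star_on A m)"
proof -
  define P where "P = {p. graft p (Leaf (Some m)) \<in> trees_on A}"
  define F where "F = (\<lambda>p. graft p (Leaf (Some m)))"
  define G where "G = (\<lambda>p. graft p (Node (Leaf None) m (Leaf None)))"
  have iff: "graft p (Node (Leaf None) m (Leaf None)) \<in> trees_on A \<longleftrightarrow>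
      graft p (Leaf (Some m)) \<in> trees_on A" for p
  proof -
    have "increasing (graft p (Node (Leaf None) m (Leaf None))) \<longleftrightarrow>
        increasing (graft p (Leaf (Some m)))"
      by (rule increasing_graft_cong) auto
    then show ?thesis
      by (auto simp: trees_on_def labels_graft)
  qed
  have empty: "l = Leaf None" if "graft p (Node l m (Leaf None)) \<in> trees_on A" for p l
  proof -
    have "increasing (Node l m (Leaf None))" "set (labels l) \<subseteq> A"
      using that increasing_graftD[of p "Node l m (Leaf None)"]
      by (auto simp: trees_on_def labels_graft)
    then have "b \<notin> set (labels l)" for b
      using assms[of b] by (meson UnI1 increasing.simps(2) leD subsetD)
    then have "labels l = []" by (cases "labels l") auto
    then show ?thesis by (cases l rule: labels.cases) auto
  qed
  have "circ_on A m = G ` P"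
  proof (intro set_eqI iffI)
    fix \<tau> assume "\<tau> \<in> circ_on A m"
    then obtain p l where p: "\<tau> = graft p (Node l m (Leaf None))" "\<tau> \<in> trees_on A"
      by (auto simp: circ_on_def)
    then have "l = Leaf None" using empty[of p l] by simp
    with p have "\<tau> = G p" "p \<in> P"
      by (simp_all add: G_def P_def iff)
    then show "\<tau> \<in> G ` P" by blast
  next
    fix \<tau> assume "\<tau> \<in> G ` P"
    then obtain p where "p \<in> P" "\<tau> = G p" by blast
    then have "\<tau> = graft p (Node (Leaf None) m (Leaf None))" "\<tau> \<in> trees_on A"
      by (simp_all add: G_def P_def iff)
    then show "\<tau> \<in> circ_on A m"
      unfolding circ_on_def by blast
  qed
  moreover have "star_on A m = F ` P"
    by (auto simp: star_on_def F_def P_def)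
  moreover have "gf (G ` P) = fls_X ^ 2 * gf (F ` P)"
    by (rule gf_images)
      (auto simp: inj_on_def F_def G_def graft_Node_inject graft_Leaf_inject emp_graft)
  ultimately show ?thesis by simp
qed

text \<open>The least label sits at the root, which is the rightmost leaf only in a one-node tree.\<close>

lemma star_on_least:
  assumes "\<And>a. a \<in> A \<Longrightarrow> m \<le> a"
  shows "star_on A m = (if A = {m} then {Leaf (Some m)} else {})"
proof -
  have "graft p (Leaf (Some m)) \<in> trees_on A \<longleftrightarrow> p = [] \<and> A = {m}" for p
  proof (cases p)
    case (Cons x q)
    obtain l a where x: "x = (l, a)" by force
    have "graft p (Leaf (Some m)) \<in> trees_on A \<Longrightarrow> a < m \<and> a \<in> A"
      using Cons x by (auto simp: trees_on_def labels_graft)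
    then show ?thesis using assms[of a] Cons by auto
  qed (auto simp: trees_on_def)
  then have "star_on A m = {graft p (Leaf (Some m)) | p. p = [] \<and> A = {m}}"
    unfolding star_on_def by blast
  then show ?thesis by simp
qed

section \<open>Comparison with the polynomials V\<close>

text \<open>
  Raising \<open>j\<close> lowers \<open>k = n - j + 1\<close>. Following the recurrence of \<open>V\<close>, the values at negative
  indices are computed for \<open>j\<close> increasing from \<open>1\<close>, then those at positive indices for \<open>j\<close>
  decreasing from \<open>n\<close>.
\<close>

lemma V_eq_gf:
  assumes "n \<ge> 1" "j \<in> {1..n}"
  shows "V n (int (n - j + 1)) = gf (circ_on {1..n} j) \<and>
    V n (- int (n - j + 1)) = gf (star_on {1..n} j)"
  using assms
proof (induction n arbitrary: j rule: less_induct)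
  case (less n)
  show ?case
  proof (cases "n = 1")
    case True
    have "star_on {1::nat} 1 = {Leaf (Some 1)}"
      by (subst star_on_least) auto
    then have "gf (star_on {1} 1) = 1" by (simp add: gf_def)
    then show ?thesis
      using circ_on_greatest[of "{1}" 1] less.prems True V_1_1 V_1_minus_1 by simp
  next
    case False
    then have n: "n \<ge> 2" using less.prems by simp
    have star: "V n (- int (n - j + 1)) = gf (star_on {1..n} j)" if "1 \<le> j" "j \<le> n" for j
      using that
    proof (induction j rule: dec_induct)
      case base
      have "{1..n} \<noteq> {1}" 
        using n by (auto simp: set_eq_iff intro!: exI[of _ n])
      then have "star_on {1..n} 1 = {}"
        by (subst star_on_least) auto
      then show ?case
        using n V_minus_self[of n] by (simp add: gf_def)
    next
      case (step j)
      have "V n (- int (n - j)) = V n (- int (n - j) - 1) + fls_X_inv * V (n - 1) (int (n - j))"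
        using step by (intro V_minus) auto
      also have "- int (n - j) - 1 = - int (n - j + 1)" by simp
      also have "V n (- int (n - j + 1)) = gf (star_on {1..n} j)"
        using step by simp
      also have "V (n - 1) (int (n - j)) = gf (circ_on {1..n - 1} j)"
      proof -
        have "n - 1 - j + 1 = n - j" using step by simp
        then show ?thesis using less.IH[of "n - 1" j] step n by simp
      qed
      also have "\<dots> = gf (circ_on ({1..n} - {Suc j}) j)"
        using step by (intro gf_remove_label(2)[symmetric]) auto
      also have "gf (star_on {1..n} j) + fls_X_inv * \<dots> = gf (star_on {1..n} (Suc j))"
        using step by (intro star_on_Suc[symmetric]) auto
      finally show ?case using step by (simp add: Suc_diff_Suc)
    qed
    have "V n (int (n - j + 1)) = gf (circ_on {1..n} j)" if "j \<le> n" "1 \<le> j" for j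
      using that
    proof (induction j rule: inc_induct)
      case base
      then show ?case
        using V_one[OF n] star[of n] n circ_on_greatest[of "{1..n}" n] by simp
    next
      case (step j)
      have "V n (int (n - j + 1)) =
          V n (int (n - j + 1) - 1) + fls_X * V (n - 1) (- int (n - j + 1) + 1)"
        using step by (intro V_plus) auto
      also have "int (n - j + 1) - 1 = int (n - Suc j + 1)" using step by simp
      also have "- int (n - j + 1) + 1 = - int (n - 1 - j + 1)" using step by simp
      also have "V n (int (n - Suc j + 1)) = gf (circ_on {1..n} (Suc j))"
        using step by simp
      also have "V (n - 1) (- int (n - 1 - j + 1)) = gf (star_on {1..n - 1} j)"
        using less.IH[of "n - 1" j] step n by simp
      also have "\<dots> = gf (star_on ({1..n} - {Suc j}) j)"
        using step by (intro gf_remove_label(1)[symmetric]) auto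
      also have "gf (circ_on {1..n} (Suc j)) + fls_X * \<dots> = gf (circ_on {1..n} j)"
        using step by (intro circ_on_Suc[symmetric]) auto
      finally show ?case .
    qed
    then show ?thesis using star less.prems by simp
  qed
qed

theorem theorem2p2:
  fixes n k :: nat
  assumes "1 \<le> k" and "k \<le> n"
  shows "V n (int k) = (\<Sum>\<tau>\<in>trees_circ n (n - k + 1). fls_X ^ emp \<tau>)
       \<and> V n (- int k) = (\<Sum>\<tau>\<in>trees_star n (n - k + 1). fls_X ^ emp \<tau>)"
proof -
  have j: "n - k + 1 \<in> {1..n}" and n: "1 \<le> n" and k: "n - (n - k + 1) + 1 = k"
    using assms by auto
  show ?thesis
    using V_eq_gf[OF n j] unfolding k trees_circ_eq[OF n] trees_star_eq gf_def .
qed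

end
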